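(* If a digraph $G$ is an orientation of an undirected graph $\hat{G}$, then $b(G)\leq 4b(\hat{G})$.
   Context: Graphs and digraphs are finite, without loops or multiple edges/arcs. An orientation of an undirected graph assigns each edge exactly one of its two directions. A bar is a horizontal line segment of positive length in the plane; bars do not overlap (bars at the same height may at most share an endpoint). A channel is a vertical strip of positive width. Two bars see each other if there is an unblocked channel between them, i.e. a vertical strip of positive width meeting both bars such that no other bar meets the part of the strip between the two. Visibilities between two bars of the same vertex are ignored. Directed case: a $t$-bar visibility representation of a digraph $G$ assigns each vertex at most $t$ bars in the plane so that, for distinct vertices $x,y$, there is an arc $xy$ (from $x$ to $y$) in $G$ if and only if some bar for $x$ sees some bar for $y$ above it along an unblocked channel. The bar visibility number $b(G)$ is the least $t$ such that $G$ has a $t$-bar visibility representation. Undirected case: a $t$-bar visibility representation of a graph $H$ assigns each vertex at most $t$ bars in the plane so that two distinct vertices are adjacent if and only if some bar for one sees some bar for the other along an unblocked channel. The bar visibility number $b(H)$ is the least $t$ such that $H$ has a $t$-bar visibility representation. *)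

theory Defs
  imports Complex_Main "Graph_Theory.Pair_Digraph"
begin

text \<open>
  Digraphs are \<^locale>\<open>pair_digraph\<close>s (finite, loopless, no multiple arcs); undirected
  graphs are \<^locale>\<open>pair_graph\<close>s, where the edge between \<open>u\<close> and \<open>v\<close> is the pair of arcs
  \<open>(u, v)\<close>, \<open>(v, u)\<close>.
\<close>

definition orientation_of :: "'a pair_pre_digraph \<Rightarrow> 'a pair_pre_digraph \<Rightarrow> bool" where
  "orientation_of G H \<longleftrightarrow>
     pverts G = pverts H \<and> parcs G \<subseteq> parcs H \<and>
     (\<forall>u v. (u, v) \<in> parcs H \<longrightarrow> ((u, v) \<in> parcs G \<longleftrightarrow> (v, u) \<notin> parcs G))"

text \<open>The bar \<open>p\<close> is the segment \<open>[bar_left p, bar_right p] \<times> {bar_height p}\<close> of the plane.\<close>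

record bar =
  bar_height :: real
  bar_left :: real
  bar_right :: real

definition bar_span :: "bar \<Rightarrow> real set" where
  "bar_span p = {bar_left p..bar_right p}"

definition non_overlapping :: "bar \<Rightarrow> bar \<Rightarrow> bool" where
  "non_overlapping p q \<longleftrightarrow>
     (bar_height p = bar_height q \<longrightarrow> bar_right p \<le> bar_left q \<or> bar_right q \<le> bar_left p)"

text \<open>
  A family \<open>B\<close> of bar sets indexed by the vertices in \<open>V\<close>. Two bars of the family are
  different if they differ as bars or belong to different vertices, so different vertices
  cannot share a bar.
\<close>

definition bar_assignment :: "'a set \<Rightarrow> nat \<Rightarrow> ('a \<Rightarrow> bar set) \<Rightarrow> bool" where
  "bar_assignment V t B \<longleftrightarrow>
     (\<forall>x\<in>V. finite (B x) \<and> card (B x) \<le> t) \<and>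
     (\<forall>x\<in>V. \<forall>p\<in>B x. bar_left p < bar_right p) \<and>
     (\<forall>x\<in>V. \<forall>y\<in>V. \<forall>p\<in>B x. \<forall>q\<in>B y. (x, p) \<noteq> (y, q) \<longrightarrow> non_overlapping p q)"

text \<open>
  Among the set of bars \<open>S\<close>, the bar \<open>p\<close> sees \<open>q\<close> above it: a channel \<open>[a, b] \<times> \<real>\<close> of
  positive width, lying within the horizontal extent of both bars, meets no bar of \<open>S\<close>
  strictly between them. Taking the channel closed or open makes no difference, since
  it can always be shrunk.
\<close>

definition sees_above :: "bar set \<Rightarrow> bar \<Rightarrow> bar \<Rightarrow> bool" where
  "sees_above S p q \<longleftrightarrow>
     bar_height p < bar_height q \<and>
     (\<exists>a b. a < b \<and> {a..b} \<subseteq> bar_span p \<and> {a..b} \<subseteq> bar_span q \<and>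
        (\<forall>r\<in>S. bar_height p < bar_height r \<and> bar_height r < bar_height q \<longrightarrow>
               {a..b} \<inter> bar_span r = {}))"

definition sees :: "bar set \<Rightarrow> bar \<Rightarrow> bar \<Rightarrow> bool" where
  "sees S p q \<longleftrightarrow> sees_above S p q \<or> sees_above S q p"

definition directed_bar_representation ::
  "'a pair_pre_digraph \<Rightarrow> nat \<Rightarrow> ('a \<Rightarrow> bar set) \<Rightarrow> bool" where
  "directed_bar_representation G t B \<longleftrightarrow>
     bar_assignment (pverts G) t B \<and>
     (\<forall>x\<in>pverts G. \<forall>y\<in>pverts G. x \<noteq> y \<longrightarrow>
        ((x, y) \<in> parcs G \<longleftrightarrow>
         (\<exists>p\<in>B x. \<exists>q\<in>B y. sees_above (\<Union>z\<in>pverts G. B z) p q)))"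

definition undirected_bar_representation ::
  "'a pair_pre_digraph \<Rightarrow> nat \<Rightarrow> ('a \<Rightarrow> bar set) \<Rightarrow> bool" where
  "undirected_bar_representation H t B \<longleftrightarrow>
     bar_assignment (pverts H) t B \<and>
     (\<forall>x\<in>pverts H. \<forall>y\<in>pverts H. x \<noteq> y \<longrightarrow>
        ((x, y) \<in> parcs H \<longleftrightarrow>
         (\<exists>p\<in>B x. \<exists>q\<in>B y. sees (\<Union>z\<in>pverts H. B z) p q)))"

text \<open>
  The minima exist for all finite (di)graphs: represent each edge or arc by two bars of
  its own, horizontally disjoint from all other bars.
\<close>

definition directed_bar_visibility_number :: "'a pair_pre_digraph \<Rightarrow> nat" where
  "directed_bar_visibility_number G = (LEAST t. \<exists>B. directed_bar_representation G t B)"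

definition undirected_bar_visibility_number :: "'a pair_pre_digraph \<Rightarrow> nat" where
  "undirected_bar_visibility_number H = (LEAST t. \<exists>B. undirected_bar_representation H t B)"

end

theory Submission
  imports Defs
begin

text \<open>
  Among any \<open>m\<close> of the bars of a representation of \<open>H\<close> at most \<open>3 m\<close> pairs see each other.
  By Hall's theorem, the visibilities realising the arcs of \<open>G\<close> can therefore be charged to
  their end bars so that each bar is charged at most three times, and each vertex at most
  \<open>3 t\<close> times when \<open>t = b(H)\<close>. Give every vertex one long central bar at height \<open>0\<close>, and for
  every arc charged to it one short bar just above or below the central bar of the other end
  of the arc, depending on the direction. This uses at most \<open>3 t + 1\<close> bars per vertex, and
  \<open>3 t + 1 \<le> 4 t\<close> unless \<open>t = 0\<close>, in which case there are no arcs.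
\<close>

section \<open>Hall's marriage theorem\<close>

text \<open>Induction on the number of indices. If some nonempty proper subfamily is tight, it is
  matched on its own and the remaining indices are matched outside its union. Otherwise every
  nonempty proper subfamily has an element to spare, so one index may take any element of its
  set.\<close>

lemma hall_matching:
  assumes "finite I" "\<And>i. i \<in> I \<Longrightarrow> finite (A i)"
    and "\<And>J. J \<subseteq> I \<Longrightarrow> card J \<le> card (\<Union>i\<in>J. A i)"
  shows "\<exists>f. inj_on f I \<and> (\<forall>i\<in>I. f i \<in> A i)"
  using assms
proof (induction "card I" arbitrary: I A rule: less_induct)
  case less
  show ?case
  proof (cases "I = {}")
    case True
    then show ?thesis by simp
  next
    case False
    show ?thesis
    proof (cases "\<exists>J. J \<noteq> {} \<and> J \<subset> I \<and> card (\<Union>i\<in>J. A i) = card J")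
      case True
      then obtain J where J: "J \<noteq> {}" "J \<subset> I" and tight: "card (\<Union>i\<in>J. A i) = card J"
        by blast
      let ?U = "\<Union>i\<in>J. A i"
      have fJ: "finite J" and fU: "finite ?U"
        using J less.prems(1,2) finite_subset [of J I] by auto
      have "\<exists>f. inj_on f J \<and> (\<forall>i\<in>J. f i \<in> A i)"
        using J less.prems by (intro less.hyps) (auto intro: psubset_card_mono finite_subset)
      then obtain f where f: "inj_on f J" "\<And>i. i \<in> J \<Longrightarrow> f i \<in> A i" by blast
      have "\<exists>g. inj_on g (I - J) \<and> (\<forall>i\<in>I - J. g i \<in> A i - ?U)"
      proof (rule less.hyps)
        show "card (I - J) < card I"
          using J less.prems(1) by (intro psubset_card_mono) auto
        show "card K \<le> card (\<Union>i\<in>K. A i - ?U)" if K: "K \<subseteq> I - J" for K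
        proof -
          have fK: "finite K" using K less.prems(1) by (auto intro: finite_subset)
          have fV: "finite (\<Union>i\<in>K. A i - ?U)" using fK K less.prems(2) by auto
          have "card J + card K = card (J \<union> K)"
            using K fJ fK by (intro card_Un_disjoint [symmetric]) auto
          also have "\<dots> \<le> card (\<Union>i\<in>J \<union> K. A i)"
            using J K by (intro less.prems(3)) auto
          \<comment> \<open>Hall's condition for \<open>J \<union> K\<close> passes to
            \<open>K\<close> outside \<open>?U\<close>, since \<open>?U\<close> accounts for exactly
            \<open>card J\<close> of the elements.\<close>
          also have "(\<Union>i\<in>J \<union> K. A i) = ?U \<union> (\<Union>i\<in>K. A i - ?U)" by auto
          also have "card \<dots> = card J + card (\<Union>i\<in>K. A i - ?U)"
            using fU fV tight by (subst card_Un_disjoint) auto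
          finally show ?thesis by simp
        qed
      qed (use less.prems in auto)
      then obtain g where g: "inj_on g (I - J)" "\<And>i. i \<in> I - J \<Longrightarrow> g i \<in> A i - ?U" by blast
      let ?h = "\<lambda>i. if i \<in> J then f i else g i"
      have "inj_on ?h I"
      proof (rule inj_onI)
        fix i j assume "i \<in> I" "j \<in> I" "?h i = ?h j"
        then show "i = j"
          using inj_onD [OF f(1)] inj_onD [OF g(1)] f(2) g(2)
          by (cases "i \<in> J"; cases "j \<in> J") (auto, (metis DiffI UN_I DiffD2)+)
      qed
      moreover have "\<forall>i\<in>I. ?h i \<in> A i" using f g by auto
      ultimately show ?thesis by blast
    next
      case no_tight: False
      obtain i where i: "i \<in> I" using False by blast
      have "card (A i) \<ge> 1" using less.prems(3) [of "{i}"] i by simp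
      then obtain x where x: "x \<in> A i" by fastforce
      have "\<exists>g. inj_on g (I - {i}) \<and> (\<forall>j\<in>I - {i}. g j \<in> A j - {x})"
      proof (rule less.hyps)
        show "card (I - {i}) < card I"
          using i less.prems(1) by (intro psubset_card_mono) auto
        show "card K \<le> card (\<Union>j\<in>K. A j - {x})" if K: "K \<subseteq> I - {i}" for K
        proof (cases "K = {}")
          case False
          have "card K \<le> card (\<Union>j\<in>K. A j)" using K by (intro less.prems(3)) auto
          \<comment> \<open>\<open>K\<close> omits \<open>i\<close>, so it is proper and not tight;
            its union exceeds \<open>card K\<close> and can afford to lose \<open>x\<close>.\<close>
          moreover have "card (\<Union>j\<in>K. A j) \<noteq> card K" using K False i no_tight by blast
          moreover have "(\<Union>j\<in>K. A j - {x}) = (\<Union>j\<in>K. A j) - {x}" by auto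
          ultimately show ?thesis by (auto simp: card_Diff_singleton_if)
        qed simp
      qed (use less.prems in auto)
      then obtain g where g: "inj_on g (I - {i})" "\<And>j. j \<in> I - {i} \<Longrightarrow> g j \<in> A j - {x}" by blast
      have "inj_on (g(i := x)) I"
        using g by (force simp: inj_on_def)
      moreover have "\<forall>j\<in>I. (g(i := x)) j \<in> A j" using g x by auto
      ultimately show ?thesis by blast
    qed
  qed
qed

section \<open>Counting visibilities with a sweeping line\<close>

text \<open>
  Bars are cut by vertical lines as half-open intervals, so that a line through an endpoint
  shows the situation just to its right.
\<close>

definition meets_line :: "real \<Rightarrow> bar \<Rightarrow> bool" where
  "meets_line c p \<longleftrightarrow> bar_left p \<le> c \<and> c < bar_right p"

definition consecutive :: "bar set \<Rightarrow> real \<Rightarrow> bar \<Rightarrow> bar \<Rightarrow> bool" where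
  "consecutive S c p q \<longleftrightarrow>
     meets_line c p \<and> meets_line c q \<and> bar_height p < bar_height q \<and>
     (\<forall>r\<in>S. bar_height p < bar_height r \<and> bar_height r < bar_height q \<longrightarrow> \<not> meets_line c r)"

text \<open>The left end of the channel is such a line: positive width puts it into both half-open
  intervals, and closedness of the channel keeps it off the bars in between.\<close>

lemma sees_above_imp_consecutive:
  assumes "sees_above S p q"
  shows "\<exists>c. consecutive S c p q"
proof -
  obtain a b where "a < b" and "{a..b} \<subseteq> bar_span p" "{a..b} \<subseteq> bar_span q"
    and "bar_height p < bar_height q"
    and free: "\<And>r. r \<in> S \<Longrightarrow> bar_height p < bar_height r \<Longrightarrow> bar_height r < bar_height q
      \<Longrightarrow> {a..b} \<inter> bar_span r = {}"
    using assms unfolding sees_above_def by blast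
  moreover have "\<not> meets_line a r"
    if "r \<in> S" "bar_height p < bar_height r" "bar_height r < bar_height q" for r
  proof -
    have "a \<notin> bar_span r" using free [OF that] \<open>a < b\<close> by (meson atLeastAtMost_iff disjoint_iff less_imp_le order_refl)
    then show ?thesis by (auto simp: meets_line_def bar_span_def)
  qed
  ultimately have "consecutive S a p q"
    by (auto simp: consecutive_def meets_line_def bar_span_def)
  then show ?thesis ..
qed

text \<open>Deleting bars destroys no visibility between remaining ones. This gives the linear bound
  for every subset of the bars, as Hall's condition demands.\<close>

lemma consecutive_subset: "consecutive S c p q \<Longrightarrow> T \<subseteq> S \<Longrightarrow> consecutive T c p q"
  by (auto simp: consecutive_def)

text \<open>Move the line left from \<open>a\<close> as far as the pair stays consecutive: it stops
  where \<open>p\<close> or \<open>q\<close> starts, or where a bar separating them ends.\<close>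

lemma consecutive_leftmost:
  assumes "finite S" "consecutive S a p q"
  shows "consecutive S (bar_left p) p q \<or> consecutive S (bar_left q) p q \<or>
    (\<exists>r\<in>S. bar_height p < bar_height r \<and> bar_height r < bar_height q \<and>
       consecutive S (bar_right r) p q)"
proof -
  \<comment> \<open>The candidate stopping positions; the maximum is the first one reached from
    \<open>a\<close>.\<close>
  define C where "C = {bar_left p, bar_left q} \<union> bar_right ` {r \<in> S. bar_height p < bar_height r \<and>
    bar_height r < bar_height q \<and> bar_right r \<le> a}"
  have fC: "finite C" "C \<noteq> {}" using assms(1) by (auto simp: C_def)
  have le: "x \<le> Max C" if "x \<in> C" for x using that fC by simp
  have Max_in: "Max C \<in> C" using fC by simp
  then have "Max C \<le> a" using assms(2) by (auto simp: C_def consecutive_def meets_line_def)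
  moreover have "bar_left p \<le> Max C" "bar_left q \<le> Max C"
    by (rule le, simp add: C_def)+
  moreover have "\<not> meets_line (Max C) r"
    if r: "r \<in> S" "bar_height p < bar_height r" "bar_height r < bar_height q" for r
  proof
    assume m: "meets_line (Max C) r"
    \<comment> \<open>\<open>r\<close> starts no later than \<open>a\<close> but misses the line at
      \<open>a\<close>, so it has ended by then and its right end competes in the maximum.\<close>
    then have "bar_right r \<le> a"
      using assms(2) r \<open>Max C \<le> a\<close> by (force simp: consecutive_def meets_line_def)
    then have "bar_right r \<le> Max C" using r by (intro le) (auto simp: C_def)
    with m show False by (simp add: meets_line_def)
  qed
  ultimately have "consecutive S (Max C) p q"
    using assms(2) by (auto simp: consecutive_def meets_line_def)
  moreover have "Max C = bar_left p \<or> Max C = bar_left q \<or>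
    (\<exists>r\<in>S. bar_height p < bar_height r \<and> bar_height r < bar_height q \<and> Max C = bar_right r)"
    using Max_in unfolding C_def by blast
  ultimately show ?thesis by metis
qed

text \<open>On a fixed line the gaps between consecutive bars have disjoint height ranges: if two
  ranges overlap and differ, an end of one lies strictly inside the other. Bars of equal height on
  the same line coincide by non-overlapping.\<close>

lemma consecutive_unique:
  assumes no: "\<And>p q. p \<in> S \<Longrightarrow> q \<in> S \<Longrightarrow> p \<noteq> q \<Longrightarrow> non_overlapping p q"
    and S: "p \<in> S" "q \<in> S" "p' \<in> S" "q' \<in> S"
    and c: "consecutive S c p q" "consecutive S c p' q'"
    and h: "max (bar_height p) (bar_height p') < min (bar_height q) (bar_height q')"
  shows "p = p' \<and> q = q'"
proof -
  have eq: "r = s" if "r \<in> S" "s \<in> S" "meets_line c r" "meets_line c s"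
    "bar_height r = bar_height s" for r s
    using no [of r s] that by (force simp: non_overlapping_def meets_line_def)
  have "bar_height p = bar_height p'" "bar_height q = bar_height q'"
    using c h S unfolding consecutive_def by (smt (verit))+
  then show ?thesis using eq S c by (auto simp: consecutive_def)
qed

text \<open>
  Sweeping a vertical line to the right, a new consecutive pair appears only where a bar starts
  (a pair with the bar below and one with the bar above) or ends (the pair that it separated).
\<close>

lemma card_consecutive_le:
  assumes fin: "finite S"
    and no: "\<And>p q. p \<in> S \<Longrightarrow> q \<in> S \<Longrightarrow> p \<noteq> q \<Longrightarrow> non_overlapping p q"
    and E: "E \<subseteq> S \<times> S" "\<And>p q. (p, q) \<in> E \<Longrightarrow> \<exists>c. consecutive S c p q"
  shows "card E \<le> 3 * card S"
proof -
  \<comment> \<open>Three tokens per bar \<open>r\<close>: 0 for the pair above \<open>r\<close>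
    when it starts, 1 for the pair below \<open>r\<close> when it starts, 2 for the pair that meets
    when \<open>r\<close> ends.\<close>
  define event where "event = (\<lambda>(p, q) (r, k::nat).
    (k = 0 \<and> r = p \<and> consecutive S (bar_left r) p q) \<or>
    (k = 1 \<and> r = q \<and> consecutive S (bar_left r) p q) \<or>
    (k = 2 \<and> bar_height p < bar_height r \<and> bar_height r < bar_height q \<and>
       consecutive S (bar_right r) p q))"
  have "\<exists>v\<in>S \<times> {..<3}. event e v" if e: "e \<in> E" for e
  proof -
    obtain p q where e': "e = (p, q)" by fastforce
    obtain c where "consecutive S c p q" using E e e' by blast
    moreover have "p \<in> S" "q \<in> S" using E e e' by auto
    ultimately show ?thesis
      using consecutive_leftmost [OF fin, of c p q] e'
      by (fastforce simp: event_def)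
  qed
  then obtain f where f: "\<And>e. e \<in> E \<Longrightarrow> f e \<in> S \<times> {..<3}" "\<And>e. e \<in> E \<Longrightarrow> event e (f e)"
    by metis
  have "inj_on f E"
  proof (rule inj_onI)
    fix e e' assume ee: "e \<in> E" "e' \<in> E" "f e = f e'"
    obtain p q where e: "e = (p, q)" by fastforce
    obtain p' q' where e': "e' = (p', q')" by fastforce
    obtain r k where v: "f e = (r, k)" by fastforce
    have S: "p \<in> S" "q \<in> S" "p' \<in> S" "q' \<in> S" using E ee e e' by auto
    have "event (p, q) (r, k)" "event (p', q') (r, k)"
      using f(2) ee e e' v by metis+
    \<comment> \<open>Pairs with the same token are consecutive on the same line and share the lower
      bar, share the upper bar, or both straddle the height of \<open>r\<close>; in each case their
      height ranges overlap.\<close>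
    then show "e = e'"
      using consecutive_unique [OF no S] unfolding e e'
      by (fastforce simp: event_def consecutive_def)
  qed
  moreover have "finite (S \<times> {..<3::nat})" using fin by simp
  ultimately have "card E \<le> card (S \<times> {..<3::nat})"
    by (intro card_inj_on_le [of f] image_subsetI f(1))
  then show ?thesis by (simp add: card_cartesian_product)
qed

section \<open>Layout with central bars and leaves\<close>

text \<open>Central bars occupy disjoint blocks of length \<open>N\<close> at height 0. Each arc has
  a private unit slot in the block of its centre, so its leaf sees that central bar and nothing
  else.\<close>

lemma star_layout:
  fixes G :: "'a pair_pre_digraph" and leaf_end :: "'a \<times> 'a \<Rightarrow> 'a"
  assumes "pair_fin_digraph G"
    and leaf_end: "\<And>a. a \<in> parcs G \<Longrightarrow> leaf_end a \<in> {fst a, snd a}"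
    and card: "\<And>v. v \<in> pverts G \<Longrightarrow> card {a \<in> parcs G. leaf_end a = v} \<le> k"
  shows "\<exists>B. directed_bar_representation G (Suc k) B"
proof -
  interpret pair_fin_digraph G by fact
  define centre where "centre = (\<lambda>a. if leaf_end a = snd a then fst a else snd a)"
  obtain i :: "'a \<Rightarrow> nat" where i: "inj_on i (pverts G)"
    using finite_imp_inj_to_nat_seg [OF pair_finite_verts] by blast
  obtain j :: "'a \<times> 'a \<Rightarrow> nat" and n where j: "j ` parcs G = {m. m < n}" "inj_on j (parcs G)"
    using finite_imp_inj_to_nat_seg [OF pair_finite_arcs] by blast
  \<comment> \<open>The successor keeps central bars of positive length when there are no
    arcs.\<close>
  define N where "N = Suc n"
  \<comment> \<open>Division by \<open>N\<close> recovers the block of the centre, and the remainder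
    recovers the arc.\<close>
  define slot where "slot = (\<lambda>a. i (centre a) * N + j a)"
  define star where "star = (\<lambda>v. \<lparr>bar_height = 0, bar_left = real (i v * N),
    bar_right = real (i v * N + N)\<rparr>)"
  \<comment> \<open>The leaf lies above exactly when it stands for the head, so that visibility runs
    from tail to head.\<close>
  define leaf where "leaf = (\<lambda>a. \<lparr>bar_height = (if leaf_end a = snd a then 1 else - 1),
    bar_left = real (slot a), bar_right = real (slot a + 1)\<rparr>)"
  define B where "B = (\<lambda>v. insert (star v) (leaf ` {a \<in> parcs G. leaf_end a = v}))"
  let ?S = "\<Union>z\<in>pverts G. B z"

  have j_less: "j a < N" if "a \<in> parcs G" for a using imageI [OF that, of j] j(1) by (simp add: N_def)
  have centre_in: "centre a \<in> pverts G" if "a \<in> parcs G" for a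
    using that arc_fst_in_verts arc_snd_in_verts by (auto simp: centre_def)
  have slot_inj: "a = b" if "a \<in> parcs G" "b \<in> parcs G" "slot a = slot b" for a b
  proof -
    have "slot a mod N = j a" "slot b mod N = j b"
      using j_less [OF that(1)] j_less [OF that(2)] by (simp_all add: slot_def)
    then show ?thesis using that inj_onD [OF j(2)] by metis
  qed
  have slot_div: "slot a div N = i (centre a)" if "a \<in> parcs G" for a
    using j_less [OF that] by (auto simp: slot_def)
  have centre_eq: "centre a = v"
    if "a \<in> parcs G" "v \<in> pverts G" "i v * N < slot a + 1" "slot a < i v * N + N" for a v
  proof -
    have "slot a div N = i v" using that by (intro div_nat_eqI) (auto simp: mult.commute)
    then show ?thesis using slot_div [OF that(1)] inj_onD [OF i] that centre_in by metis
  qed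

  \<comment> \<open>Seeing forces the spans to overlap properly; this necessary condition suffices
    to exclude unwanted visibilities.\<close>
  have overlap: "bar_height p < bar_height q" "bar_left p < bar_right q" "bar_left q < bar_right p"
    if "sees_above ?S p q" for p q
    using that by (force simp: sees_above_def bar_span_def)+
  have heights: "bar_height r \<in> {-1, 0, 1}" if "r \<in> ?S" for r
    using that by (auto simp: B_def star_def leaf_def split: if_splits)
  have sees: "sees_above ?S p q"
    if "a \<in> parcs G" "bar_height p < bar_height q"
      "(p = star (centre a) \<and> q = leaf a) \<or> (p = leaf a \<and> q = star (centre a))" for p q a
  proof -
    \<comment> \<open>The whole extent of the leaf is the channel; no bar has a height strictly
      between 0 and 1 or between -1 and 0.\<close>
    have "bar_left (star (centre a)) \<le> bar_left (leaf a)"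
      "bar_right (leaf a) \<le> bar_right (star (centre a))" "bar_left (leaf a) < bar_right (leaf a)"
      using j_less [OF that(1)] by (auto simp: star_def leaf_def slot_def)
    moreover have "\<not> (bar_height p < bar_height r \<and> bar_height r < bar_height q)" if "r \<in> ?S" for r
      using heights [OF that] \<open>_ \<or> _\<close> by (auto simp: star_def leaf_def split: if_splits)
    ultimately show ?thesis
      using that unfolding sees_above_def bar_span_def
      by (intro conjI exI [of _ "bar_left (leaf a)"] exI [of _ "bar_right (leaf a)"]) auto
  qed

  have "bar_assignment (pverts G) (Suc k) B"
    unfolding bar_assignment_def
  proof (intro conjI ballI impI)
    fix v assume v: "v \<in> pverts G"
    have fin: "finite {a \<in> parcs G. leaf_end a = v}" using pair_finite_arcs by simp
    then show "finite (B v)" by (simp add: B_def)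
    have "card (B v) \<le> Suc (card (leaf ` {a \<in> parcs G. leaf_end a = v}))"
      unfolding B_def using fin by (simp add: card_insert_if)
    also have "\<dots> \<le> Suc k" using card [OF v] card_image_le [OF fin, of leaf] by simp
    finally show "card (B v) \<le> Suc k" .
  next
    fix v p assume "v \<in> pverts G" "p \<in> B v"
    then show "bar_left p < bar_right p" by (auto simp: B_def star_def leaf_def N_def)
  next
    fix x y p q
    assume V: "x \<in> pverts G" "y \<in> pverts G" and B: "p \<in> B x" "q \<in> B y" and ne: "(x, p) \<noteq> (y, q)"
    consider (stars) "p = star x" "q = star y"
      | (leaves) a b where "a \<in> parcs G" "b \<in> parcs G" "p = leaf a" "q = leaf b"
          "leaf_end a = x" "leaf_end b = y"
      | (mixed) "bar_height p \<noteq> bar_height q"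
      using B by (auto simp: B_def star_def leaf_def)
    then show "non_overlapping p q"
    proof cases
      case stars
      then have "i x \<noteq> i y" using ne V inj_onD [OF i] by blast
      then have "Suc (i x) \<le> i y \<or> Suc (i y) \<le> i x" by linarith
      then have "Suc (i x) * N \<le> i y * N \<or> Suc (i y) * N \<le> i x * N"
        using mult_le_mono1 by blast
      then have "i x * N + N \<le> i y * N \<or> i y * N + N \<le> i x * N"
        by (simp add: add.commute)
      then show ?thesis
        unfolding non_overlapping_def stars star_def bar.simps of_nat_le_iff by blast
    next
      case leaves
      then have "slot a \<noteq> slot b" using ne slot_inj by blast
      then show ?thesis unfolding non_overlapping_def leaves leaf_def by simp linarith
    next
      case mixed
      then show ?thesis by (simp add: non_overlapping_def)
    qed
  qed
  moreover have "(x, y) \<in> parcs G \<longleftrightarrow> (\<exists>p\<in>B x. \<exists>q\<in>B y. sees_above ?S p q)"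
    if V: "x \<in> pverts G" "y \<in> pverts G" and "x \<noteq> y" for x y
  proof
    assume a: "(x, y) \<in> parcs G"
    show "\<exists>p\<in>B x. \<exists>q\<in>B y. sees_above ?S p q"
    proof (cases "leaf_end (x, y) = y")
      case True
      then have "sees_above ?S (star x) (leaf (x, y))"
        by (intro sees [OF a]) (auto simp: star_def leaf_def centre_def)
      moreover have "leaf (x, y) \<in> B y" using a True by (auto simp: B_def)
      ultimately show ?thesis by (auto simp: B_def)
    next
      case False
      then have "sees_above ?S (leaf (x, y)) (star y)"
        by (intro sees [OF a]) (auto simp: star_def leaf_def centre_def)
      moreover have "leaf (x, y) \<in> B x" using a False leaf_end [OF a] by (auto simp: B_def)
      ultimately show ?thesis by (auto simp: B_def)
    qed
  next
    assume "\<exists>p\<in>B x. \<exists>q\<in>B y. sees_above ?S p q"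
    then obtain p q where B: "p \<in> B x" "q \<in> B y" and pq: "sees_above ?S p q" by blast
    note lt = overlap [OF pq]
    consider (stars) "p = star x" "q = star y"
      | (up) a where "a \<in> parcs G" "p = star x" "q = leaf a" "leaf_end a = y"
      | (down) a where "a \<in> parcs G" "p = leaf a" "q = star y" "leaf_end a = x"
      | (leaves) a b where "a \<in> parcs G" "b \<in> parcs G" "p = leaf a" "q = leaf b"
          "leaf_end a = x" "leaf_end b = y"
      using B by (auto simp: B_def)
    then show "(x, y) \<in> parcs G"
    proof cases
      case stars
      then show ?thesis using lt by (simp add: star_def)
    next
      case up
      then have "i x * N < slot a + 1" "slot a < i x * N + N"
        using lt unfolding up(2,3) star_def leaf_def bar.simps of_nat_less_iff by blast+
      then have "centre a = x" using centre_eq up V by blast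
      moreover have "leaf_end a = snd a"
        using lt up by (auto simp: star_def leaf_def split: if_splits)
      ultimately have "a = (x, y)" using up by (auto simp: centre_def)
      then show ?thesis using up by simp
    next
      case down
      then have "i y * N < slot a + 1" "slot a < i y * N + N"
        using lt unfolding down(2,3) star_def leaf_def bar.simps of_nat_less_iff by blast+
      then have "centre a = y" using centre_eq down V by blast
      moreover have "leaf_end a \<noteq> snd a"
        using lt down by (auto simp: star_def leaf_def split: if_splits)
      ultimately have "a = (x, y)" using down leaf_end [of a] by (auto simp: centre_def)
      then show ?thesis using down by simp
    next
      \<comment> \<open>A leaf at height -1 could see one at height 1 only within a common slot, but
        slots are private to arcs.\<close>
      case leaves
      then have "slot a < slot b + 1" "slot b < slot a + 1"
        using lt unfolding leaves(3,4) leaf_def bar.simps of_nat_less_iff by blast+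
      then have "a = b" using slot_inj leaves by simp
      then show ?thesis using leaves \<open>x \<noteq> y\<close> by simp
    qed
  qed
  ultimately show ?thesis unfolding directed_bar_representation_def by blast
qed

section \<open>Charging arcs to their ends\<close>

text \<open>Every bar offers three tokens, and each arc takes a token of one of the two bars
  realising it. A set of arcs using the bars \<open>T\<close> has at most \<open>3 * card T\<close>
  members, which is Hall's condition. The vertex owning the chosen bar is charged.\<close>

lemma charge_arcs_to_ends:
  assumes G: "pair_digraph G" and H: "pair_graph H" and GH: "orientation_of G H"
    and B: "undirected_bar_representation H t B"
  shows "\<exists>leaf_end. (\<forall>a\<in>parcs G. leaf_end a \<in> {fst a, snd a}) \<and>
    (\<forall>v\<in>pverts G. card {a \<in> parcs G. leaf_end a = v} \<le> 3 * t)"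
proof -
  interpret G: pair_digraph G by fact
  define S where "S = (\<Union>z\<in>pverts H. B z)"
  have V: "pverts G = pverts H" and sub: "parcs G \<subseteq> parcs H"
    and anti: "\<And>u v. (u, v) \<in> parcs G \<Longrightarrow> (v, u) \<notin> parcs G"
    using GH unfolding orientation_of_def by blast+
  have ba: "bar_assignment (pverts H) t B"
    and adj: "\<And>x y. x \<in> pverts H \<Longrightarrow> y \<in> pverts H \<Longrightarrow> x \<noteq> y \<Longrightarrow>
      (x, y) \<in> parcs H \<longleftrightarrow> (\<exists>p\<in>B x. \<exists>q\<in>B y. sees S p q)"
    using B unfolding undirected_bar_representation_def S_def by blast+
  have finB: "finite (B x)" "card (B x) \<le> t" if "x \<in> pverts H" for x
    using ba that by (auto simp: bar_assignment_def)
  have no: "non_overlapping p q" if "p \<in> S" "q \<in> S" "p \<noteq> q" for p q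
    using ba that unfolding bar_assignment_def S_def by blast
  \<comment> \<open>A bar shared by two vertices would have to avoid overlapping itself, contrary to
    its positive length.\<close>
  have owner: "x = y" if "x \<in> pverts H" "y \<in> pverts H" "p \<in> B x" "p \<in> B y" for x y p
  proof (rule ccontr)
    assume "x \<noteq> y"
    then have "non_overlapping p p" "bar_left p < bar_right p"
      using ba that unfolding bar_assignment_def by blast+
    then show False by (simp add: non_overlapping_def)
  qed

  have verts: "fst a \<in> pverts H" "snd a \<in> pverts H" if "a \<in> parcs G" for a
    using that G.arc_fst_in_verts G.arc_snd_in_verts V by auto
  have "\<exists>e. sees_above S (fst e) (snd e) \<and>
      ((fst e \<in> B (fst a) \<and> snd e \<in> B (snd a)) \<or> (fst e \<in> B (snd a) \<and> snd e \<in> B (fst a)))"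
    if "a \<in> parcs G" for a
  proof -
    have "(fst a, snd a) \<in> parcs H" using that sub by auto
    with adj [of "fst a" "snd a"] verts [OF that] G.pair_no_loops [OF that]
    obtain p q where "p \<in> B (fst a)" "q \<in> B (snd a)" "sees S p q" by blast
    then show ?thesis
      unfolding sees_def by (elim disjE) (rule exI [of _ "(p, q)"] exI [of _ "(q, p)"]; simp)+
  qed
  then obtain e where e_sees: "\<And>a. a \<in> parcs G \<Longrightarrow> sees_above S (fst (e a)) (snd (e a))"
    and e_ends: "\<And>a. a \<in> parcs G \<Longrightarrow>
      (fst (e a) \<in> B (fst a) \<and> snd (e a) \<in> B (snd a)) \<or>
      (fst (e a) \<in> B (snd a) \<and> snd (e a) \<in> B (fst a))"
    by metis
  have e_S: "fst (e a) \<in> S" "snd (e a) \<in> S" if "a \<in> parcs G" for a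
    using e_ends [OF that] verts [OF that] by (auto simp: S_def)
  \<comment> \<open>The two bars determine the unordered pair of ends, and an orientation has just
    one arc on it.\<close>
  have e_inj: "inj_on e (parcs G)"
  proof (rule inj_onI)
    fix a b assume ab: "a \<in> parcs G" "b \<in> parcs G" "e a = e b"
    have "(fst a = fst b \<and> snd a = snd b) \<or> (fst a = snd b \<and> snd a = fst b)"
      using e_ends [OF ab(1)] e_ends [OF ab(2)] verts [OF ab(1)] verts [OF ab(2)] ab(3) owner
      by metis
    then show "a = b" using anti ab by (metis prod.collapse)
  qed

  let ?A = "\<lambda>a. {fst (e a), snd (e a)} \<times> {..<3::nat}"
  have "\<exists>f. inj_on f (parcs G) \<and> (\<forall>a\<in>parcs G. f a \<in> ?A a)"
  proof (rule hall_matching)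
    fix J assume J: "J \<subseteq> parcs G"
    define T where "T = (\<Union>a\<in>J. {fst (e a), snd (e a)})"
    have "finite J" using J G.pair_finite_arcs by (rule finite_subset)
    then have "finite T" by (simp add: T_def)
    have "T \<subseteq> S" using J e_S by (auto simp: T_def)
    have "card J = card (e ` J)"
      using inj_on_subset [OF e_inj J] by (simp add: card_image)
    also have "\<dots> \<le> 3 * card T"
    proof (rule card_consecutive_le [OF \<open>finite T\<close>])
      show "non_overlapping p q" if "p \<in> T" "q \<in> T" "p \<noteq> q" for p q
        using no that \<open>T \<subseteq> S\<close> by blast
      show "e ` J \<subseteq> T \<times> T"
        unfolding T_def by (intro image_subsetI) (auto simp: mem_Times_iff)
      show "\<exists>c. consecutive T c p q" if "(p, q) \<in> e ` J" for p q
        using that J e_sees sees_above_imp_consecutive consecutive_subset [OF _ \<open>T \<subseteq> S\<close>]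
        by (metis fst_conv imageE snd_conv subsetD)
    qed
    also have "\<dots> = card (T \<times> {..<3::nat})" by (simp add: card_cartesian_product)
    also have "T \<times> {..<3} = (\<Union>a\<in>J. ?A a)" by (auto simp: T_def)
    finally show "card J \<le> card (\<Union>a\<in>J. ?A a)" .
  qed (use G.pair_finite_arcs in auto)
  then obtain f where f: "inj_on f (parcs G)" "\<And>a. a \<in> parcs G \<Longrightarrow> f a \<in> ?A a" by blast

  define leaf_end where "leaf_end = (\<lambda>a. if fst (f a) \<in> B (snd a) then snd a else fst a)"
  have in_B: "fst (f a) \<in> B (leaf_end a)" if "a \<in> parcs G" for a
    using f(2) [OF that] e_ends [OF that] by (auto simp: leaf_end_def)
  have "card {a \<in> parcs G. leaf_end a = v} \<le> 3 * t" if "v \<in> pverts G" for v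
  proof -
    have "card {a \<in> parcs G. leaf_end a = v} \<le> card (B v \<times> {..<3::nat})"
    proof (rule card_inj_on_le)
      show "inj_on f {a \<in> parcs G. leaf_end a = v}" using f(1) by (rule inj_on_subset) auto
      show "f ` {a \<in> parcs G. leaf_end a = v} \<subseteq> B v \<times> {..<3}"
        using in_B f(2) by (fastforce simp: mem_Times_iff)
      show "finite (B v \<times> {..<3::nat})" using finB that V by simp
    qed
    also have "\<dots> \<le> 3 * t" using finB(2) [of v] that V by (simp add: card_cartesian_product)
    finally show ?thesis .
  qed
  moreover have "\<forall>a\<in>parcs G. leaf_end a \<in> {fst a, snd a}" by (simp add: leaf_end_def)
  ultimately show ?thesis by blast
qed

section \<open>Existence of representations and the bound\<close>

text \<open>Used to see that \<open>H\<close> has some representation, so that its bar visibility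
  number is attained. Forgetting which bar is above turns the arcs of \<open>G\<close> into the
  edges of \<open>H\<close>.\<close>

lemma directed_imp_undirected_bar_representation:
  assumes "pair_graph H" and GH: "orientation_of G H" and B: "directed_bar_representation G t B"
  shows "undirected_bar_representation H t B"
proof -
  interpret H: pair_graph H by fact
  let ?S = "\<Union>z\<in>pverts H. B z"
  have V: "pverts G = pverts H" and sub: "parcs G \<subseteq> parcs H"
    and one: "\<And>u v. (u, v) \<in> parcs H \<Longrightarrow> (u, v) \<in> parcs G \<or> (v, u) \<in> parcs G"
    using GH unfolding orientation_of_def by blast+
  have "sym (parcs H)" using H.pair_sym_arcs by (simp add: symmetric_def)
  then have arcs: "(x, y) \<in> parcs H \<longleftrightarrow> (x, y) \<in> parcs G \<or> (y, x) \<in> parcs G" for x y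
    using sub one [of x y] symD [of "parcs H" y x] by blast
  have "bar_assignment (pverts H) t B"
    using B V by (simp add: directed_bar_representation_def)
  moreover have "(x, y) \<in> parcs H \<longleftrightarrow> (\<exists>p\<in>B x. \<exists>q\<in>B y. sees ?S p q)"
    if "x \<in> pverts H" "y \<in> pverts H" "x \<noteq> y" for x y
  proof -
    have "(x, y) \<in> parcs G \<longleftrightarrow> (\<exists>p\<in>B x. \<exists>q\<in>B y. sees_above ?S p q)"
      "(y, x) \<in> parcs G \<longleftrightarrow> (\<exists>q\<in>B y. \<exists>p\<in>B x. sees_above ?S q p)"
      using B that V unfolding directed_bar_representation_def by simp_all
    then show ?thesis unfolding arcs sees_def by blast
  qed
  ultimately show ?thesis unfolding undirected_bar_representation_def by blast
qed

text \<open>Without bars nothing is visible, so \<open>H\<close>, and with it \<open>G\<close>, has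
  no arcs.\<close>

lemma undirected_bar_representation_0:
  assumes B: "undirected_bar_representation H 0 B" and GH: "orientation_of G H"
  shows "directed_bar_representation G 0 B"
proof -
  have V: "pverts G = pverts H" and sub: "parcs G \<subseteq> parcs H"
    using GH by (simp_all add: orientation_of_def)
  have ba: "bar_assignment (pverts H) 0 B"
    using B by (simp add: undirected_bar_representation_def)
  then have empty: "B x = {}" if "x \<in> pverts H" for x
    using that unfolding bar_assignment_def
    by (metis card_0_eq le_zero_eq)
  have "(x, y) \<notin> parcs H" if "x \<in> pverts H" "y \<in> pverts H" "x \<noteq> y" for x y
    using B that empty by (simp add: undirected_bar_representation_def)
  then show ?thesis
    unfolding directed_bar_representation_def V using ba sub empty by blast
qed

theorem theorem4p8:
  fixes G H :: "'a pair_pre_digraph"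
  assumes "pair_digraph G"
    and "pair_graph H"
    and "orientation_of G H"
  shows "directed_bar_visibility_number G \<le> 4 * undirected_bar_visibility_number H"
proof -
  interpret G: pair_digraph G by fact
  define t where "t = undirected_bar_visibility_number H"
  have star: "\<exists>B. directed_bar_representation G (Suc k) B"
    if "\<forall>a\<in>parcs G. leaf_end a \<in> {fst a, snd a}"
      "\<forall>v\<in>pverts G. card {a \<in> parcs G. leaf_end a = v} \<le> k" for leaf_end k
    by (rule star_layout [OF G.pair_fin_digraph_axioms, of leaf_end]) (use that in blast)+
  have "\<exists>B. directed_bar_representation G (Suc (card (parcs G))) B"
    \<comment> \<open>A crude charging, every arc to its tail, is enough for mere existence.\<close>
    by (rule star [of fst]) (simp_all add: card_mono G.pair_finite_arcs)
  then have "\<exists>t B. undirected_bar_representation H t B"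
    using directed_imp_undirected_bar_representation [OF assms(2,3)] by blast
  then obtain B where B: "undirected_bar_representation H t B"
    unfolding t_def undirected_bar_visibility_number_def by (elim exE [OF LeastI_ex])
  have least: "directed_bar_visibility_number G \<le> s" if "directed_bar_representation G s C" for s C
    unfolding directed_bar_visibility_number_def by (rule Least_le, rule exI, rule that)
  show ?thesis
  proof (cases "t = 0")
    case True
    then show ?thesis using least [OF undirected_bar_representation_0 [OF _ assms(3)]] B by simp
  next
    case False
    obtain C where "directed_bar_representation G (Suc (3 * t)) C"
      using charge_arcs_to_ends [OF assms B] star by blast
    then have "directed_bar_visibility_number G \<le> Suc (3 * t)" by (rule least)
    also have "\<dots> \<le> 4 * t" using False by simp
    finally show ?thesis by (simp add: t_def)
  qed
qed

end
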